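(* Let $\Omega\subset X$ be a $\nu$-measurable set with $0<\nu(\Omega)<\nu(X)$. Then the following assertions are equivalent: (i) $\Omega$ is $m$-calibrable; (ii) there exists a $\nu$-measurable function $\tau$ equal to $1$ in $\Omega$ such that $$-\lambda_\Omega^m\,\tau\in\Delta_1^m\chi_\Omega\quad\text{in } X;$$ (iii) $$-\lambda_\Omega^m\,\tau^*\in\Delta_1^m\chi_\Omega\quad\text{in } X,$$ for $$\tau^*(x)=\begin{cases}1 & \text{if } x\in\Omega,\\ -\dfrac1{\lambda_\Omega^m}m_x(\Omega) & \text{if } x\in X\setminus\Omega.\end{cases}$$
   Context: Metric random walk space: $(X,d)$ is a Polish metric space with its Borel $\sigma$-algebra and $m=(m_x)_{x\in X}$ is a family of Borel probability measures on $X$ such that $x\mapsto m_x(A)$ is Borel for every Borel set $A$, and each $m_x$ has finite first moment ($\int_X d(z,y)\,dm_x(y)<\infty$ for some, hence every, $z\in X$). $\nu$ is a $\sigma$-finite Radon measure on $X$ that is invariant, $\nu(A)=\int_X m_x(A)\,d\nu(x)$, and reversible for $m$: for every Borel $C\subset X\times X$, $\int_X\int_X\chi_C(x,y)\,dm_x(y)d\nu(x)=\int_X\int_X\chi_C(x,y)\,dm_y(x)d\nu(y)$. Put $L_m(A,B)=\int_A\int_B dm_x(y)d\nu(x)$; the space is assumed $m$-connected: $L_m(A,B)>0$ for any $\nu$-measurable sets $A,B$ of positive $\nu$-measure with $A\cup B=X$. $P_m(E)=L_m(E,X\setminus E)=\int_E\int_{X\setminus E}dm_x(y)d\nu(x)$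 and $\lambda_\Omega^m:=\frac{P_m(\Omega)}{\nu(\Omega)}$. The $m$-Cheeger constant of $\Omega$ is $h_1^m(\Omega)=\inf\left\{\frac{P_m(E)}{\nu(E)}: E\subset\Omega \ \nu\text{-measurable},\ \nu(E)>0\right\}$; $\Omega$ is $m$-calibrable if $h_1^m(\Omega)=\lambda_\Omega^m$. $\chi_\Omega$ is the characteristic function of $\Omega$. For $\nu$-measurable $u$, $TV_m(u)=\frac12\int_X\int_X|u(y)-u(x)|\,dm_x(y)d\nu(x)\in[0,\infty]$; $\mathcal F_m:L^2(X,\nu)\to[0,+\infty]$, $\mathcal F_m(u)=TV_m(u)$. $w\in\partial\mathcal F_m(u)$ iff $\mathcal F_m(u)<\infty$ and $\mathcal F_m(z)\ge\mathcal F_m(u)+\int_X w(z-u)\,d\nu$ for all $z\in L^2(X,\nu)$. For $u,v\in L^2(X,\nu)$: $v\in\Delta_1^m u$ iff $-v\in\partial\mathcal F_m(u)$. *)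

theory Defs
  imports "HOL-Probability.Probability"
begin

text \<open>
  Throughout, measures on \<open>X\<close> live on the Borel sets, and ``\<open>\<nu>\<close>-measurable'' refers to
  \<open>completion \<nu>\<close>. If \<open>\<nu>\<close> is invariant, a \<open>\<nu>\<close>-null set is \<open>m x\<close>-null for \<open>\<nu>\<close>-almost every
  \<open>x\<close>; hence a \<open>\<nu>\<close>-measurable set is measurable for \<open>completion (m x)\<close> for almost every \<open>x\<close>,
  which is why the kernel is completed as well wherever \<open>\<nu>\<close>-measurable objects are integrated.
\<close>

definition radon_measure :: "'a::topological_space measure \<Rightarrow> bool" where
  "radon_measure \<nu> \<longleftrightarrow> sets \<nu> = sets borel \<and>
     (\<forall>x. \<exists>U. open U \<and> x \<in> U \<and> emeasure \<nu> U < \<infinity>) \<and>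
     (\<forall>A\<in>sets borel. emeasure \<nu> A = (SUP K\<in>{K. compact K \<and> K \<subseteq> A}. emeasure \<nu> K))"

locale metric_random_walk =
  fixes m :: "'a::polish_space \<Rightarrow> 'a measure"
  assumes kernel: "m \<in> borel \<rightarrow>\<^sub>M prob_algebra borel"
    and finite_first_moment: "\<And>x. \<exists>z. (\<integral>\<^sup>+y. ennreal (dist z y) \<partial>m x) < \<infinity>"

locale reversible_random_walk = metric_random_walk m
  for m :: "'a::polish_space \<Rightarrow> 'a measure" +
  fixes \<nu> :: "'a measure"
  assumes sigma_finite: "sigma_finite_measure \<nu>"
    and radon: "radon_measure \<nu>"
    and invariant: "\<And>A. A \<in> sets borel \<Longrightarrow> emeasure \<nu> A = (\<integral>\<^sup>+x. emeasure (m x) A \<partial>\<nu>)"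
    and reversible: "\<And>C :: ('a \<times> 'a) set. C \<in> sets borel \<Longrightarrow>
      (\<integral>\<^sup>+x. (\<integral>\<^sup>+y. indicator C (x, y) \<partial>m x) \<partial>\<nu>) = (\<integral>\<^sup>+y. (\<integral>\<^sup>+x. indicator C (x, y) \<partial>m y) \<partial>\<nu>)"

definition m_interaction ::
    "('a \<Rightarrow> 'a measure) \<Rightarrow> 'a measure \<Rightarrow> 'a set \<Rightarrow> 'a set \<Rightarrow> ennreal" where
  "m_interaction m \<nu> A B = (\<integral>\<^sup>+x\<in>A. emeasure (completion (m x)) B \<partial>completion \<nu>)"

definition m_connected :: "('a \<Rightarrow> 'a measure) \<Rightarrow> 'a measure \<Rightarrow> bool" where
  "m_connected m \<nu> \<longleftrightarrow>
     (\<forall>A\<in>sets (completion \<nu>). \<forall>B\<in>sets (completion \<nu>).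
        emeasure (completion \<nu>) A > 0 \<longrightarrow> emeasure (completion \<nu>) B > 0 \<longrightarrow> A \<union> B = UNIV \<longrightarrow>
        m_interaction m \<nu> A B > 0)"

definition m_perimeter :: "('a \<Rightarrow> 'a measure) \<Rightarrow> 'a measure \<Rightarrow> 'a set \<Rightarrow> ennreal" where
  "m_perimeter m \<nu> E = m_interaction m \<nu> E (- E)"

definition perimeter_ratio :: "('a \<Rightarrow> 'a measure) \<Rightarrow> 'a measure \<Rightarrow> 'a set \<Rightarrow> ennreal" where
  "perimeter_ratio m \<nu> E = m_perimeter m \<nu> E / emeasure (completion \<nu>) E"

definition cheeger_constant :: "('a \<Rightarrow> 'a measure) \<Rightarrow> 'a measure \<Rightarrow> 'a set \<Rightarrow> ennreal" where
  "cheeger_constant m \<nu> \<Omega> =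
     (INF E\<in>{E\<in>sets (completion \<nu>). E \<subseteq> \<Omega> \<and> emeasure (completion \<nu>) E > 0}.
        perimeter_ratio m \<nu> E)"

definition m_calibrable :: "('a \<Rightarrow> 'a measure) \<Rightarrow> 'a measure \<Rightarrow> 'a set \<Rightarrow> bool" where
  "m_calibrable m \<nu> \<Omega> \<longleftrightarrow> cheeger_constant m \<nu> \<Omega> = perimeter_ratio m \<nu> \<Omega>"

definition m_total_variation ::
    "('a \<Rightarrow> 'a measure) \<Rightarrow> 'a measure \<Rightarrow> ('a \<Rightarrow> real) \<Rightarrow> ennreal" where
  "m_total_variation m \<nu> u =
     (1 / 2) * (\<integral>\<^sup>+x. (\<integral>\<^sup>+y. ennreal \<bar>u y - u x\<bar> \<partial>completion (m x)) \<partial>completion \<nu>)"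

text \<open>
  Elements of \<open>L\<^sup>2(X, \<nu>)\<close> are represented by functions; every notion below depends only on
  their \<open>\<nu>\<close>-a.e. classes.
\<close>

definition L2_functions :: "'a measure \<Rightarrow> ('a \<Rightarrow> real) set" where
  "L2_functions \<nu> =
     {u \<in> borel_measurable (completion \<nu>). integrable (completion \<nu>) (\<lambda>x. (u x)\<^sup>2)}"

text \<open>
  The inequality is read in \<open>ereal\<close>, since the functional may be infinite at \<open>z\<close> and
  the integral may be negative.
\<close>

definition L2_subdifferential ::
    "'a measure \<Rightarrow> (('a \<Rightarrow> real) \<Rightarrow> ennreal) \<Rightarrow> ('a \<Rightarrow> real) \<Rightarrow> ('a \<Rightarrow> real) set" where
  "L2_subdifferential \<nu> F u =
     {w \<in> L2_functions \<nu>. F u < \<infinity> \<and>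
        (\<forall>z\<in>L2_functions \<nu>. enn2ereal (F z) \<ge>
           enn2ereal (F u) + ereal (\<integral>x. w x * (z x - u x) \<partial>completion \<nu>))}"

definition one_laplacian ::
    "('a \<Rightarrow> 'a measure) \<Rightarrow> 'a measure \<Rightarrow> ('a \<Rightarrow> real) \<Rightarrow> ('a \<Rightarrow> real) set" where
  "one_laplacian m \<nu> u =
     {v \<in> L2_functions \<nu>. u \<in> L2_functions \<nu> \<and>
        (\<lambda>x. - v x) \<in> L2_subdifferential \<nu> (m_total_variation m \<nu>) u}"

end

theory Submission
  imports Defs
begin

text \<open>
  Write \<open>\<lambda> = P(\<Omega>) / \<nu>(\<Omega>)\<close>. The function of assertion (iii), multiplied by \<open>\<lambda>\<close>, is
  \<open>w = \<lambda> \<chi>\<^sub>\<Omega> - m\<^sub>x(\<Omega>) \<chi>\<close>, the last \<open>\<chi>\<close> being that of the complement of \<open>\<Omega>\<close>. The integral of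
  \<open>w\<close> over \<open>\<Omega>\<close> is \<open>\<lambda> \<nu>(\<Omega>) = P(\<Omega>) = TV(\<chi>\<^sub>\<Omega>)\<close>, so \<open>w\<close> is a subgradient of \<open>TV\<close> at \<open>\<chi>\<^sub>\<Omega>\<close> as soon as
  \<open>TV(z) \<ge> \<integral> w z d\<nu>\<close> for all square-integrable \<open>z\<close>.

  For characteristic functions \<open>z = \<plusminus>\<chi>\<^sub>F\<close> this says \<open>P(F) \<ge> \<bar>\<integral>\<^sub>F w d\<nu>\<bar>\<close>, which calibrability gives:
  cut the space into the four pieces defined by \<open>F\<close> and \<open>\<Omega>\<close>, and compare \<open>P\<close> with \<open>\<lambda> \<nu>\<close> on
  \<open>\<Omega> \<inter> F\<close> for the one sign and on \<open>\<Omega> - F\<close> for the other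
  (\<open>calibrable_set_bounds\<close>). Reversibility enters as the symmetry of the interaction between sets.
  For a nonnegative function both \<open>TV\<close> and the integral against \<open>w\<close> are integrals over \<open>t\<close> of
  their values on the superlevel sets, by the coarea formula and the layer-cake formula
  (\<open>total_variation_bound_of_perimeter_bound\<close>). A general \<open>z\<close> is split into its positive and
  negative parts, on which \<open>TV\<close> is additive; the two signs of the set inequality serve the two parts
  (\<open>calibrable_weight_subgradient\<close>). So (i) implies (iii), and connectedness makes \<open>\<lambda>\<close> positive, so
  that the function in (iii) is a witness for (ii).

  Conversely, if \<open>\<lambda> \<tau>\<close> is a subgradient at \<open>\<chi>\<^sub>\<Omega>\<close> with \<open>\<tau> = 1\<close> on \<open>\<Omega>\<close>, then testing with \<open>\<chi>\<^sub>E\<close> for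
  \<open>E \<subseteq> \<Omega>\<close> gives \<open>P(E) \<ge> P(\<Omega>) + \<lambda> (\<nu>(E) - \<nu>(\<Omega>)) = \<lambda> \<nu>(E)\<close>, which is calibrability
  (\<open>calibrable_of_one_laplacian\<close>).

  The analysis is done with Borel functions and sets. By invariance, functions that agree almost
  everywhere for \<open>\<nu>\<close> agree almost everywhere for \<open>m\<^sub>x\<close>, for almost every \<open>x\<close> (\<open>AE_kernel\<close>), and
  this carries the results over to the completions.
\<close>

(* As a simplification rule it would replace every set measured in a completion by its main part. *)
declare emeasure_completion [simp del]

section \<open>Square-integrable functions\<close>

lemma L2_integrable_mult:
  assumes "u \<in> L2_functions M" "v \<in> L2_functions M"
  shows "integrable (completion M) (\<lambda>x. u x * v x)"
proof (rule Bochner_Integration.integrable_bound)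
  show "integrable (completion M) (\<lambda>x. (u x)\<^sup>2 + (v x)\<^sup>2)"
    using assms unfolding L2_functions_def by auto
  show "(\<lambda>x. u x * v x) \<in> borel_measurable (completion M)"
    using assms unfolding L2_functions_def by auto
  have "\<bar>s * t\<bar> \<le> s\<^sup>2 + t\<^sup>2" for s t :: real
    using sum_squares_bound[of "\<bar>s\<bar>" "\<bar>t\<bar>"] by (auto simp: abs_mult intro: order_trans[rotated])
  then show "AE x in completion M. norm (u x * v x) \<le> norm ((u x)\<^sup>2 + (v x)\<^sup>2)"
    by simp
qed

lemma L2_diff:
  assumes "u \<in> L2_functions M" "v \<in> L2_functions M"
  shows "(\<lambda>x. u x - v x) \<in> L2_functions M"
proof -
  have "integrable (completion M) (\<lambda>x. (u x)\<^sup>2 + (v x)\<^sup>2 - 2 * (u x * v x))"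
    using assms L2_integrable_mult[OF assms] unfolding L2_functions_def by auto
  then show ?thesis
    using assms unfolding L2_functions_def by (auto simp: power2_diff algebra_simps)
qed

lemma L2_mono:
  assumes "u \<in> L2_functions M" "v \<in> borel_measurable (completion M)"
    and "AE x in completion M. \<bar>v x\<bar> \<le> \<bar>u x\<bar>"
  shows "v \<in> L2_functions M"
proof -
  have "integrable (completion M) (\<lambda>x. (v x)\<^sup>2)"
  proof (rule Bochner_Integration.integrable_bound)
    show "integrable (completion M) (\<lambda>x. (u x)\<^sup>2)"
      using assms unfolding L2_functions_def by auto
    show "AE x in completion M. norm ((v x)\<^sup>2) \<le> norm ((u x)\<^sup>2)"
      using assms(3) by eventually_elim (simp add: abs_le_square_iff)
  qed (use assms(2) in measurable)
  with assms(2) show ?thesis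
    unfolding L2_functions_def by simp
qed

section \<open>Passing between the completion and Borel versions\<close>

lemma borel_measurable_completion_AE_cong:
  assumes g: "g \<in> borel_measurable (completion M)" and eq: "AE x in M. g x = f x"
  shows "f \<in> borel_measurable (completion M)"
proof (rule measurableI)
  fix S :: "'b set" assume S: "S \<in> sets borel"
  have "AE x in completion M. x \<in> g -` S \<inter> space M \<longleftrightarrow> x \<in> f -` S \<inter> space M"
    using AE_completion[OF eq] by eventually_elim auto
  moreover have "g -` S \<inter> space M \<in> sets (completion M)"
    using measurable_sets[OF g S] by simp
  ultimately show "f -` S \<inter> space (completion M) \<in> sets (completion M)"
    unfolding space_completion by (rule completion.in_sets_AE) simp
qed simp

context reversible_random_walk
begin

abbreviation interaction :: "'a set \<Rightarrow> 'a set \<Rightarrow> ennreal" where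
  "interaction \<equiv> m_interaction m \<nu>"

abbreviation total_variation :: "('a \<Rightarrow> real) \<Rightarrow> ennreal" where
  "total_variation \<equiv> m_total_variation m \<nu>"

lemma sets_nu [measurable_cong, simp]: "sets \<nu> = sets borel"
  using radon unfolding radon_measure_def by simp

lemma space_nu [simp]: "space \<nu> = UNIV"
  using sets_eq_imp_space_eq[OF sets_nu] by simp

lemma prob_space_kernel: "prob_space (m x)"
  and sets_kernel [measurable_cong, simp]: "sets (m x) = sets borel"
  using measurable_space[OF kernel, of x] by (auto simp: space_prob_algebra)

lemma space_kernel [simp]: "space (m x) = UNIV"
  using sets_eq_imp_space_eq[OF sets_kernel] by simp

lemma kernel_subprob [measurable]: "m \<in> borel \<rightarrow>\<^sub>M subprob_algebra borel"
  using kernel by (rule measurable_prob_algebraD)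

lemma emeasure_kernel_measurable [measurable]:
  "B \<in> sets borel \<Longrightarrow> (\<lambda>x. emeasure (m x) B) \<in> borel_measurable borel"
  by (rule measurable_emeasure_kernel[OF kernel_subprob])

lemma nn_integral_kernel_measurable:
  assumes "case_prod g \<in> borel_measurable (borel \<Otimes>\<^sub>M borel)"
  shows "(\<lambda>x. \<integral>\<^sup>+y. g x y \<partial>m x) \<in> borel_measurable borel"
  using assms kernel_subprob by (rule nn_integral_measurable_subprob_algebra2)

text \<open>
  By invariance, a Borel set that is null for \<open>\<nu>\<close> has average \<open>m\<^sub>x\<close>-measure zero.
\<close>

lemma AE_kernel:
  assumes "AE x in \<nu>. Q x"
  shows "AE x in \<nu>. AE y in m x. Q y"
proof -
  from AE_E[OF assms] obtain N
    where N: "{x \<in> space \<nu>. \<not> Q x} \<subseteq> N" "emeasure \<nu> N = 0" "N \<in> sets \<nu>" .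
  have "(\<integral>\<^sup>+x. emeasure (m x) N \<partial>\<nu>) = 0"
    using invariant[of N] N by simp
  then have "AE x in \<nu>. emeasure (m x) N = 0"
    using N by (subst (asm) nn_integral_0_iff_AE) auto
  then show ?thesis
  proof eventually_elim
    case (elim x)
    then have "N \<in> null_sets (m x)"
      using N by auto
    then show ?case
      using N by (intro AE_I'[where N = N]) auto
  qed
qed

text \<open>
  A \<open>\<nu>\<close>-measurable set differs from its main part by a subset of a \<open>\<nu>\<close>-null set, which almost every
  kernel measure ignores. Hence the completed kernel in \<open>m_interaction\<close> may be traded for the
  kernel itself.
\<close>

lemma AE_kernel_completion_version:
  assumes "B \<in> sets (completion \<nu>)"
  shows "AE x in \<nu>. B \<in> sets (completion (m x)) \<and>
           emeasure (completion (m x)) B = emeasure (m x) (main_part \<nu> B)"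
  using AE_kernel[OF AE_in_main_part[OF assms]]
proof eventually_elim
  case (elim x)
  have main: "main_part \<nu> B \<in> sets (m x)"
    using main_part_sets[OF assms] by simp
  have ae: "AE y in completion (m x). y \<in> main_part \<nu> B \<longleftrightarrow> y \<in> B"
    using elim by (rule AE_completion)
  have B: "B \<in> sets (completion (m x))"
    using ae main by (rule completion.in_sets_AE[OF _ sets_completionI_sets]) simp
  have "emeasure (completion (m x)) B = emeasure (completion (m x)) (main_part \<nu> B)"
  proof (rule emeasure_eq_AE)
    show "AE y in completion (m x). y \<in> B \<longleftrightarrow> y \<in> main_part \<nu> B"
      using ae by eventually_elim blast
  qed (use B main in simp_all)
  also have "\<dots> = emeasure (m x) (main_part \<nu> B)"
    using main by (simp only: emeasure_completion sets_completionI_sets main_part)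
  finally show ?case
    using B by blast
qed

lemma emeasure_completion_kernel_measurable:
  assumes "B \<in> sets (completion \<nu>)"
  shows "(\<lambda>x. emeasure (completion (m x)) B) \<in> borel_measurable (completion \<nu>)"
proof (rule borel_measurable_completion_AE_cong)
  show "(\<lambda>x. emeasure (m x) (main_part \<nu> B)) \<in> borel_measurable (completion \<nu>)"
    using main_part_sets[OF assms] by (intro measurable_completion) simp
  show "AE x in \<nu>. emeasure (m x) (main_part \<nu> B) = emeasure (completion (m x)) B"
    using AE_kernel_completion_version[OF assms] by eventually_elim simp
qed

lemma emeasure_completion_kernel_le_1: "emeasure (completion (m x)) B \<le> 1"
proof (cases "B \<in> sets (completion (m x))")
  case True
  then show ?thesis
    using prob_space.emeasure_le_1[OF prob_space_kernel] by (simp add: emeasure_completion)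
qed (simp add: emeasure_notin_sets)

section \<open>The interaction between two sets\<close>

lemma interaction_union_left:
  assumes [measurable]: "A \<in> sets (completion \<nu>)" "A' \<in> sets (completion \<nu>)"
      "B \<in> sets (completion \<nu>)"
    and disj: "A \<inter> A' = {}"
  shows "interaction (A \<union> A') B = interaction A B + interaction A' B"
proof -
  note [measurable] = emeasure_completion_kernel_measurable[OF assms(3)]
  show ?thesis
    unfolding m_interaction_def using disj
    by (subst nn_integral_add[symmetric])
       (auto intro!: nn_integral_cong simp: indicator_def)
qed

lemma interaction_union_right:
  assumes [measurable]: "A \<in> sets (completion \<nu>)" "B \<in> sets (completion \<nu>)"
      "B' \<in> sets (completion \<nu>)"
    and disj: "B \<inter> B' = {}"
  shows "interaction A (B \<union> B') = interaction A B + interaction A B'"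
proof -
  note [measurable] = emeasure_completion_kernel_measurable[OF assms(2)]
    emeasure_completion_kernel_measurable[OF assms(3)]
  have "AE x in completion \<nu>. emeasure (completion (m x)) (B \<union> B') =
      emeasure (completion (m x)) B + emeasure (completion (m x)) B'"
    using AE_completion[OF AE_kernel_completion_version[OF assms(2)]]
      AE_completion[OF AE_kernel_completion_version[OF assms(3)]]
    by eventually_elim (metis plus_emeasure disj)
  then have "interaction A (B \<union> B') = (\<integral>\<^sup>+x. emeasure (completion (m x)) B * indicator A x +
      emeasure (completion (m x)) B' * indicator A x \<partial>completion \<nu>)"
    unfolding m_interaction_def
    by (intro nn_integral_cong_AE) (auto simp: distrib_right)
  also have "\<dots> = interaction A B + interaction A B'"
    unfolding m_interaction_def by (rule nn_integral_add) auto
  finally show ?thesis .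
qed

lemma interaction_main_part:
  assumes "A \<in> sets (completion \<nu>)" "B \<in> sets (completion \<nu>)"
  shows "interaction A B =
    (\<integral>\<^sup>+x. emeasure (m x) (main_part \<nu> B) * indicator (main_part \<nu> A) x \<partial>\<nu>)"
  unfolding m_interaction_def nn_integral_completion
proof (rule nn_integral_cong_AE)
  show "AE x in \<nu>. emeasure (completion (m x)) B * indicator A x =
      emeasure (m x) (main_part \<nu> B) * indicator (main_part \<nu> A) x"
    using AE_kernel_completion_version[OF assms(2)] AE_in_main_part[OF assms(1)]
    by eventually_elim (auto simp: indicator_def)
qed

text \<open>
  Reversibility applied to the rectangle of the Borel versions of the two sets.
\<close>

lemma interaction_commute:
  assumes A: "A \<in> sets (completion \<nu>)" and B: "B \<in> sets (completion \<nu>)"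
  shows "interaction A B = interaction B A"
proof -
  define A' B' where "A' = main_part \<nu> A" and "B' = main_part \<nu> B"
  have [measurable]: "A' \<in> sets borel" "B' \<in> sets borel"
    using main_part_sets[OF A] main_part_sets[OF B] by (simp_all add: A'_def B'_def)
  have inner: "(\<integral>\<^sup>+y. indicator C y * c \<partial>m x) = emeasure (m x) C * c"
    if "C \<in> sets borel" for C c x
    using that by (subst nn_integral_multc) auto
  have "interaction A B = (\<integral>\<^sup>+x. (\<integral>\<^sup>+y. indicator (A' \<times> B') (x, y) \<partial>m x) \<partial>\<nu>)"
    unfolding interaction_main_part[OF A B] A'_def[symmetric] B'_def[symmetric]
    by (simp add: inner indicator_times mult.commute[of "indicator A' _"])
  also have "A' \<times> B' \<in> sets borel"
    unfolding borel_prod[symmetric] by measurable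
  then have "(\<integral>\<^sup>+x. (\<integral>\<^sup>+y. indicator (A' \<times> B') (x, y) \<partial>m x) \<partial>\<nu>) =
      (\<integral>\<^sup>+y. (\<integral>\<^sup>+x. indicator (A' \<times> B') (x, y) \<partial>m y) \<partial>\<nu>)"
    by (rule reversible)
  also have "\<dots> = interaction B A"
    unfolding interaction_main_part[OF B A] A'_def[symmetric] B'_def[symmetric]
    by (simp add: inner indicator_times)
  finally show ?thesis .
qed

lemma interaction_le:
  assumes "A \<in> sets (completion \<nu>)"
  shows "interaction A B \<le> emeasure (completion \<nu>) A"
proof -
  have "interaction A B \<le> (\<integral>\<^sup>+x. indicator A x \<partial>completion \<nu>)"
    unfolding m_interaction_def
    by (intro nn_integral_mono) (auto simp: indicator_def emeasure_completion_kernel_le_1)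
  then show ?thesis
    using assms by simp
qed

section \<open>Total variation\<close>

lemma total_variation_cong_AE:
  assumes "AE x in \<nu>. u x = v x"
  shows "total_variation u = total_variation v"
proof -
  have "AE x in \<nu>. (\<integral>\<^sup>+y. ennreal \<bar>u y - u x\<bar> \<partial>m x) = (\<integral>\<^sup>+y. ennreal \<bar>v y - v x\<bar> \<partial>m x)"
    using assms AE_kernel[OF assms]
    by eventually_elim (auto intro!: nn_integral_cong_AE)
  then show ?thesis
    unfolding m_total_variation_def nn_integral_completion
    by (simp cong: nn_integral_cong_AE)
qed

text \<open>
  The double integral counts the jumps out of \<open>E\<close> and those into \<open>E\<close>; by symmetry they weigh the same,
  which cancels the factor \<open>1 / 2\<close>.
\<close>

lemma total_variation_indicator:
  assumes E: "E \<in> sets (completion \<nu>)"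
  shows "total_variation (indicator E) = m_perimeter m \<nu> E"
proof -
  have E': "- E \<in> sets (completion \<nu>)"
    using sets.compl_sets[OF E] by (simp add: Compl_eq_Diff_UNIV)
  note [measurable] = E E' emeasure_completion_kernel_measurable[OF E]
    emeasure_completion_kernel_measurable[OF E']
  have "AE x in completion \<nu>. (\<integral>\<^sup>+y. ennreal \<bar>indicator E y - indicator E x\<bar> \<partial>completion (m x)) =
      emeasure (completion (m x)) (- E) * indicator E x +
      emeasure (completion (m x)) E * indicator (- E) x"
    using AE_completion[OF AE_kernel_completion_version[OF E]]
      AE_completion[OF AE_kernel_completion_version[OF E']]
  proof eventually_elim
    case (elim x)
    have "(\<integral>\<^sup>+y. ennreal \<bar>indicator E y - indicator E x\<bar> \<partial>completion (m x)) =
        (\<integral>\<^sup>+y. indicator (if x \<in> E then - E else E) y \<partial>completion (m x))"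
      by (intro nn_integral_cong) (auto simp: indicator_def)
    with elim show ?case
      by auto
  qed
  then have "(\<integral>\<^sup>+x. (\<integral>\<^sup>+y. ennreal \<bar>indicator E y - indicator E x\<bar> \<partial>completion (m x)) \<partial>completion \<nu>) =
      (\<integral>\<^sup>+x. emeasure (completion (m x)) (- E) * indicator E x +
        emeasure (completion (m x)) E * indicator (- E) x \<partial>completion \<nu>)"
    by (rule nn_integral_cong_AE)
  also have "\<dots> = interaction E (- E) + interaction (- E) E"
    unfolding m_interaction_def by (rule nn_integral_add) measurable
  finally have "total_variation (indicator E) = 1 / 2 * (interaction E (- E) + interaction (- E) E)"
    unfolding m_total_variation_def by simp
  also have "interaction (- E) E = interaction E (- E)"
    by (rule interaction_commute[OF E' E])
  finally show ?thesis
    unfolding m_perimeter_def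
    by (simp add: mult_2[symmetric] mult.assoc[symmetric] ennreal_divide_times)
qed

lemma nn_integral_increment_measurable:
  fixes u :: "'a \<Rightarrow> real"
  assumes [measurable]: "u \<in> borel_measurable borel"
  shows "(\<lambda>x. \<integral>\<^sup>+y. ennreal \<bar>u y - u x\<bar> \<partial>m x) \<in> borel_measurable \<nu>"
  by (subst measurable_cong_sets[OF sets_nu refl])
     (rule nn_integral_kernel_measurable, measurable)

text \<open>
  An increment of \<open>u\<close> is the sum of those of its two parts, without cancellation, because
  \<open>u\<^sup>+\<close> and \<open>- u\<^sup>-\<close> are both nondecreasing functions of \<open>u\<close>.
\<close>

lemma total_variation_pos_neg_parts:
  fixes u :: "'a \<Rightarrow> real"
  assumes [measurable]: "u \<in> borel_measurable borel"
  shows "total_variation u = total_variation (\<lambda>x. max 0 (u x)) + total_variation (\<lambda>x. max 0 (- u x))"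
proof -
  have split: "ennreal \<bar>u y - u x\<bar> = ennreal \<bar>max 0 (u y) - max 0 (u x)\<bar> +
      ennreal \<bar>max 0 (- u y) - max 0 (- u x)\<bar>" for x y
    by (subst ennreal_plus[symmetric]) (auto simp: max_def abs_minus_commute simp del: ennreal_plus)
  have "(\<integral>\<^sup>+y. ennreal \<bar>u y - u x\<bar> \<partial>m x) =
      (\<integral>\<^sup>+y. ennreal \<bar>max 0 (u y) - max 0 (u x)\<bar> \<partial>m x) +
      (\<integral>\<^sup>+y. ennreal \<bar>max 0 (- u y) - max 0 (- u x)\<bar> \<partial>m x)" for x
    unfolding split by (rule nn_integral_add) measurable
  then show ?thesis
    unfolding m_total_variation_def nn_integral_completion
    by (simp add: nn_integral_add nn_integral_increment_measurable distrib_left)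
qed

section \<open>Coarea and layer-cake formulas\<close>

lemma kernel_sigma_finite: "sigma_finite_measure (m x)"
  using prob_space_kernel by (rule prob_space_imp_sigma_finite)

text \<open>
  The threshold \<open>t\<close> runs over the whole line, where Lebesgue measure lives; negative thresholds
  contribute nothing because of the test \<open>0 \<le> t\<close>.
\<close>

lemma layer_cake:
  fixes f :: "'a \<Rightarrow> real" and g :: "'a \<Rightarrow> ennreal"
  assumes [measurable]: "f \<in> borel_measurable \<nu>" "g \<in> borel_measurable \<nu>"
    and nonneg: "\<And>x. 0 \<le> f x"
  shows "(\<integral>\<^sup>+x. g x * ennreal (f x) \<partial>\<nu>) =
    (\<integral>\<^sup>+t. (\<integral>\<^sup>+x. g x * (if 0 \<le> t \<and> t < f x then 1 else 0) \<partial>\<nu>) \<partial>lborel)"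
proof -
  interpret pair_sigma_finite \<nu> lborel
    by (intro pair_sigma_finite.intro sigma_finite sigma_finite_lborel)
  have "(\<integral>\<^sup>+t. (if 0 \<le> t \<and> t < f x then 1 else 0) \<partial>lborel) = ennreal (f x)" for x
  proof -
    have "(\<integral>\<^sup>+t. (if 0 \<le> t \<and> t < f x then 1 else 0) \<partial>lborel) =
        (\<integral>\<^sup>+t. indicator {0..<f x} t \<partial>lborel)"
      by (intro nn_integral_cong) (auto simp: indicator_def)
    then show ?thesis
      using nonneg[of x] by simp
  qed
  then have "(\<integral>\<^sup>+x. g x * ennreal (f x) \<partial>\<nu>) =
      (\<integral>\<^sup>+x. (\<integral>\<^sup>+t. g x * (if 0 \<le> t \<and> t < f x then 1 else 0) \<partial>lborel) \<partial>\<nu>)"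
    by (simp add: nn_integral_cmult)
  also have "\<dots> = (\<integral>\<^sup>+t. (\<integral>\<^sup>+x. g x * (if 0 \<le> t \<and> t < f x then 1 else 0) \<partial>\<nu>) \<partial>lborel)"
    by (rule Fubini'[symmetric]) measurable
  finally show ?thesis .
qed

text \<open>
  The coarea formula: \<open>\<bar>f y - f x\<bar>\<close> is the length of the set of thresholds that separate
  \<open>f x\<close> from \<open>f y\<close>, and Tonelli's theorem moves the integral over thresholds outside.
\<close>

lemma total_variation_coarea:
  fixes f :: "'a \<Rightarrow> real"
  assumes [measurable]: "f \<in> borel_measurable borel"
    and nonneg: "\<And>x. 0 \<le> f x"
  shows "(\<lambda>t. total_variation (\<lambda>x. if 0 \<le> t \<and> t < f x then 1 else 0)) \<in> borel_measurable borel"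
    and "total_variation f =
      (\<integral>\<^sup>+t. total_variation (\<lambda>x. if 0 \<le> t \<and> t < f x then 1 else 0) \<partial>lborel)"
proof -
  define k :: "real \<Rightarrow> 'a \<Rightarrow> 'a \<Rightarrow> ennreal" where
    "k = (\<lambda>t x y. ennreal \<bar>(if 0 \<le> t \<and> t < f y then 1 else 0) - (if 0 \<le> t \<and> t < f x then 1 else 0)\<bar>)"
  interpret nu: sigma_finite_measure \<nu>
    by (rule sigma_finite)
  have inner [measurable]: "(\<lambda>p. \<integral>\<^sup>+y. k (fst p) (snd p) y \<partial>m (snd p)) \<in> borel_measurable (borel \<Otimes>\<^sub>M borel)"
  proof (rule nn_integral_measurable_subprob_algebra2)
    show "(\<lambda>(p, y). k (fst p) (snd p) y) \<in> borel_measurable ((borel \<Otimes>\<^sub>M borel) \<Otimes>\<^sub>M borel)"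
      unfolding k_def by measurable
    show "(\<lambda>p. m (snd p)) \<in> borel \<Otimes>\<^sub>M borel \<rightarrow>\<^sub>M subprob_algebra borel"
      by measurable
  qed
  then have joint: "(\<lambda>(t, x). \<integral>\<^sup>+y. k t x y \<partial>m x) \<in> borel_measurable (borel \<Otimes>\<^sub>M \<nu>)"
    by (simp add: case_prod_beta' cong: measurable_cong_sets sets_pair_measure_cong)
  have slice: "total_variation (\<lambda>x. if 0 \<le> t \<and> t < f x then 1 else 0) =
      1 / 2 * (\<integral>\<^sup>+x. (\<integral>\<^sup>+y. k t x y \<partial>m x) \<partial>\<nu>)" for t
    unfolding m_total_variation_def nn_integral_completion k_def ..
  have slice_measurable [measurable]: "(\<lambda>t. \<integral>\<^sup>+x. (\<integral>\<^sup>+y. k t x y \<partial>m x) \<partial>\<nu>) \<in> borel_measurable borel"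
    using joint by (rule nu.borel_measurable_nn_integral)
  show "(\<lambda>t. total_variation (\<lambda>x. if 0 \<le> t \<and> t < f x then 1 else 0)) \<in> borel_measurable borel"
    unfolding slice by measurable
  have segment: "(\<integral>\<^sup>+t. k t x y \<partial>lborel) = ennreal \<bar>f y - f x\<bar>" for x y
  proof -
    have "(\<integral>\<^sup>+t. k t x y \<partial>lborel) = (\<integral>\<^sup>+t. indicator {min (f x) (f y)..<max (f x) (f y)} t \<partial>lborel)"
      using nonneg[of x] nonneg[of y]
      by (intro nn_integral_cong) (auto simp: k_def indicator_def min_def max_def)
    then show ?thesis
      by (auto simp: min_def max_def)
  qed
  have "(\<integral>\<^sup>+t. (\<integral>\<^sup>+x. (\<integral>\<^sup>+y. k t x y \<partial>m x) \<partial>\<nu>) \<partial>lborel) =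
      (\<integral>\<^sup>+x. (\<integral>\<^sup>+t. (\<integral>\<^sup>+y. k t x y \<partial>m x) \<partial>lborel) \<partial>\<nu>)"
  proof -
    interpret pair_sigma_finite lborel \<nu>
      by (intro pair_sigma_finite.intro sigma_finite sigma_finite_lborel)
    show ?thesis
      by (rule Fubini'[symmetric])
         (use joint in \<open>simp cong: measurable_cong_sets sets_pair_measure_cong\<close>)
  qed
  also have "\<dots> = (\<integral>\<^sup>+x. (\<integral>\<^sup>+y. (\<integral>\<^sup>+t. k t x y \<partial>lborel) \<partial>m x) \<partial>\<nu>)"
  proof (rule nn_integral_cong)
    fix x
    interpret pair_sigma_finite lborel "m x"
      by (intro pair_sigma_finite.intro kernel_sigma_finite sigma_finite_lborel)
    show "(\<integral>\<^sup>+t. (\<integral>\<^sup>+y. k t x y \<partial>m x) \<partial>lborel) = (\<integral>\<^sup>+y. (\<integral>\<^sup>+t. k t x y \<partial>lborel) \<partial>m x)"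
      unfolding k_def by (rule Fubini'[symmetric]) measurable
  qed
  finally have "(\<integral>\<^sup>+t. (\<integral>\<^sup>+x. (\<integral>\<^sup>+y. k t x y \<partial>m x) \<partial>\<nu>) \<partial>lborel) =
      (\<integral>\<^sup>+x. (\<integral>\<^sup>+y. ennreal \<bar>f y - f x\<bar> \<partial>m x) \<partial>\<nu>)"
    unfolding segment .
  then show "total_variation f =
      (\<integral>\<^sup>+t. total_variation (\<lambda>x. if 0 \<le> t \<and> t < f x then 1 else 0) \<partial>lborel)"
    unfolding slice
    by (subst nn_integral_cmult) (simp_all add: m_total_variation_def nn_integral_completion)
qed

text \<open>
  An inequality between the perimeter and two weighted measures passes from sets to nonnegative
  functions by integration over superlevel sets. Keeping a difference of weights on the two sides of
  an inequality in \<open>ennreal\<close> avoids all integrability questions.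
\<close>

lemma total_variation_bound_of_perimeter_bound:
  fixes f :: "'a \<Rightarrow> real" and g h :: "'a \<Rightarrow> ennreal"
  assumes g: "g \<in> borel_measurable (completion \<nu>)" and h: "h \<in> borel_measurable (completion \<nu>)"
    and f [measurable]: "f \<in> borel_measurable borel" and nonneg: "\<And>x. 0 \<le> f x"
    and sets_bound: "\<And>F. F \<in> sets borel \<Longrightarrow>
      (\<integral>\<^sup>+x\<in>F. g x \<partial>\<nu>) \<le> m_perimeter m \<nu> F + (\<integral>\<^sup>+x\<in>F. h x \<partial>\<nu>)"
  shows "(\<integral>\<^sup>+x. g x * ennreal (f x) \<partial>\<nu>) \<le> total_variation f + (\<integral>\<^sup>+x. h x * ennreal (f x) \<partial>\<nu>)"
proof -
  interpret nu: sigma_finite_measure \<nu>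
    by (rule sigma_finite)
  have f_nu [measurable]: "f \<in> borel_measurable \<nu>"
    using f by (simp cong: measurable_cong_sets)
  from completion_ex_borel_measurable[OF g] obtain g'
    where g' [measurable]: "g' \<in> borel_measurable \<nu>" and gg': "AE x in \<nu>. g x = g' x" by blast
  from completion_ex_borel_measurable[OF h] obtain h'
    where h' [measurable]: "h' \<in> borel_measurable \<nu>" and hh': "AE x in \<nu>. h x = h' x" by blast
  let ?s = "\<lambda>t x. if 0 \<le> t \<and> t < f x then 1 else 0"
  have g_eq: "(\<integral>\<^sup>+x. g x * e x \<partial>\<nu>) = (\<integral>\<^sup>+x. g' x * e x \<partial>\<nu>)" for e
    using gg' by (intro nn_integral_cong_AE) auto
  have h_eq: "(\<integral>\<^sup>+x. h x * e x \<partial>\<nu>) = (\<integral>\<^sup>+x. h' x * e x \<partial>\<nu>)" for e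
    using hh' by (intro nn_integral_cong_AE) auto
  have slice: "(\<integral>\<^sup>+x. g' x * ?s t x \<partial>\<nu>) \<le> total_variation (?s t) + (\<integral>\<^sup>+x. h' x * ?s t x \<partial>\<nu>)" for t
  proof (cases "0 \<le> t")
    case True
    define F where "F = {x. t < f x}"
    have F: "F \<in> sets borel"
      unfolding F_def by measurable
    have s_real: "?s t = (indicator F :: 'a \<Rightarrow> real)" and s_ennreal: "?s t x = (indicator F x :: ennreal)" for x
      using True by (auto simp: F_def indicator_def)
    have "F \<in> sets (completion \<nu>)"
      using F by simp
    then show ?thesis
      unfolding s_real s_ennreal
      using sets_bound[OF F] by (simp add: total_variation_indicator g_eq h_eq)
  next
    case False
    then show ?thesis by simp
  qed
  have "(\<integral>\<^sup>+x. g x * ennreal (f x) \<partial>\<nu>) = (\<integral>\<^sup>+t. (\<integral>\<^sup>+x. g' x * ?s t x \<partial>\<nu>) \<partial>lborel)"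
    unfolding g_eq by (rule layer_cake[OF f_nu g' nonneg])
  also have "\<dots> \<le> (\<integral>\<^sup>+t. total_variation (?s t) + (\<integral>\<^sup>+x. h' x * ?s t x \<partial>\<nu>) \<partial>lborel)"
    by (intro nn_integral_mono slice)
  also have "\<dots> = (\<integral>\<^sup>+t. total_variation (?s t) \<partial>lborel) + (\<integral>\<^sup>+t. (\<integral>\<^sup>+x. h' x * ?s t x \<partial>\<nu>) \<partial>lborel)"
  proof (rule nn_integral_add)
    show "(\<lambda>t. total_variation (?s t)) \<in> borel_measurable lborel"
      using total_variation_coarea(1)[OF f nonneg] by simp
    show "(\<lambda>t. \<integral>\<^sup>+x. h' x * ?s t x \<partial>\<nu>) \<in> borel_measurable lborel"
      by measurable
  qed
  also have "\<dots> = total_variation f + (\<integral>\<^sup>+x. h x * ennreal (f x) \<partial>\<nu>)"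
    unfolding h_eq by (simp only: total_variation_coarea(2)[OF f nonneg] layer_cake[OF f_nu h' nonneg])
  finally show ?thesis .
qed

section \<open>Calibrable sets\<close>

lemma compl_completion: "A \<in> sets (completion \<nu>) \<Longrightarrow> - A \<in> sets (completion \<nu>)"
  using sets.compl_sets[of A "completion \<nu>"] by (simp add: Compl_eq_Diff_UNIV)

context
  fixes \<Omega> :: "'a set"
  assumes \<Omega>: "\<Omega> \<in> sets (completion \<nu>)"
    and \<Omega>_pos: "0 < emeasure (completion \<nu>) \<Omega>"
    and \<Omega>_fin: "emeasure (completion \<nu>) \<Omega> < \<infinity>"
begin

abbreviation ratio :: ennreal where
  "ratio \<equiv> perimeter_ratio m \<nu> \<Omega>"

lemma perimeter_le_measure: "E \<in> sets (completion \<nu>) \<Longrightarrow> m_perimeter m \<nu> E \<le> emeasure (completion \<nu>) E"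
  unfolding m_perimeter_def by (rule interaction_le)

lemma measure_subset_finite: "E \<subseteq> \<Omega> \<Longrightarrow> emeasure (completion \<nu>) E < \<infinity>"
  using emeasure_mono[of E \<Omega> "completion \<nu>"] \<Omega> \<Omega>_fin by (meson le_less_trans)

lemma ratio_times_measure: "ratio * emeasure (completion \<nu>) \<Omega> = m_perimeter m \<nu> \<Omega>"
proof -
  have "emeasure (completion \<nu>) \<Omega> / emeasure (completion \<nu>) \<Omega> = 1"
    using \<Omega>_pos \<Omega>_fin by (intro ennreal_divide_self) auto
  then show ?thesis
    unfolding perimeter_ratio_def by (simp only: ennreal_divide_times mult_1_right)
qed

lemma ratio_le_1: "ratio \<le> 1"
  unfolding perimeter_ratio_def using perimeter_le_measure[OF \<Omega>] \<Omega>_pos \<Omega>_fin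
  by (metis divide_right_mono_ennreal ennreal_divide_self infinity_ennreal_def not_gr_zero)

text \<open>
  Since \<open>\<Omega>\<close> competes in the infimum, only one inequality is at stake. Multiplied out, it also holds
  trivially for null sets \<open>E\<close>.
\<close>

lemma calibrable_iff:
  "m_calibrable m \<nu> \<Omega> \<longleftrightarrow>
     (\<forall>E\<in>sets (completion \<nu>). E \<subseteq> \<Omega> \<longrightarrow> ratio * emeasure (completion \<nu>) E \<le> m_perimeter m \<nu> E)"
proof -
  have scale: "ratio \<le> perimeter_ratio m \<nu> E \<longleftrightarrow> ratio * emeasure (completion \<nu>) E \<le> m_perimeter m \<nu> E"
    if "E \<subseteq> \<Omega>" "0 < emeasure (completion \<nu>) E" for E
    unfolding perimeter_ratio_def[of m \<nu> E] using that measure_subset_finite[of E]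
    by (auto simp: divide_less_ennreal simp flip: not_less)
  have "m_calibrable m \<nu> \<Omega> \<longleftrightarrow> ratio \<le> cheeger_constant m \<nu> \<Omega>"
    unfolding m_calibrable_def cheeger_constant_def using \<Omega> \<Omega>_pos
    by (auto intro!: antisym INF_lower)
  also have "\<dots> \<longleftrightarrow> (\<forall>E\<in>sets (completion \<nu>). E \<subseteq> \<Omega> \<longrightarrow> 0 < emeasure (completion \<nu>) E \<longrightarrow>
      ratio * emeasure (completion \<nu>) E \<le> m_perimeter m \<nu> E)"
    unfolding cheeger_constant_def by (auto simp: le_INF_iff scale)
  also have "\<dots> \<longleftrightarrow> (\<forall>E\<in>sets (completion \<nu>). E \<subseteq> \<Omega> \<longrightarrow>
      ratio * emeasure (completion \<nu>) E \<le> m_perimeter m \<nu> E)"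
    by (metis mult_zero_right not_gr_zero zero_le)
  finally show ?thesis .
qed

text \<open>
  All the perimeters that occur in the comparison of \<open>F\<close> with \<open>\<Omega>\<close>, expressed by the six
  interactions between the atoms \<open>a\<close>, \<open>b\<close>, \<open>c\<close>, \<open>d\<close> of the algebra generated by \<open>F\<close> and \<open>\<Omega>\<close>.
\<close>

lemma perimeter_four_pieces:
  assumes F: "F \<in> sets (completion \<nu>)"
  defines "a \<equiv> \<Omega> \<inter> F" and "b \<equiv> \<Omega> - F" and "c \<equiv> F - \<Omega>" and "d \<equiv> - (\<Omega> \<union> F)"
  shows "m_perimeter m \<nu> F = interaction a b + interaction a d + interaction b c + interaction c d"
    and "m_perimeter m \<nu> \<Omega> = interaction a c + interaction a d + interaction b c + interaction b d"
    and "m_perimeter m \<nu> a = interaction a b + interaction a c + interaction a d"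
    and "m_perimeter m \<nu> b = interaction a b + interaction b c + interaction b d"
    and "interaction c \<Omega> = interaction a c + interaction b c"
proof -
  have sets: "a \<in> sets (completion \<nu>)" "b \<in> sets (completion \<nu>)" "c \<in> sets (completion \<nu>)"
      "d \<in> sets (completion \<nu>)"
    unfolding a_def b_def c_def d_def using F \<Omega> by (auto intro: compl_completion)
  have disj: "a \<inter> b = {}" "a \<inter> c = {}" "a \<inter> d = {}" "b \<inter> c = {}" "b \<inter> d = {}" "c \<inter> d = {}"
    unfolding a_def b_def c_def d_def by auto
  have decomp: "F = a \<union> c" "- F = b \<union> d" "\<Omega> = a \<union> b" "- \<Omega> = c \<union> d" "- a = b \<union> (c \<union> d)" "- b = a \<union> (c \<union> d)"
    unfolding a_def b_def c_def d_def by auto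
  have commute: "interaction b a = interaction a b" "interaction c a = interaction a c"
      "interaction c b = interaction b c"
    using sets by (auto intro: interaction_commute)
  have left: "interaction (s \<union> t) r = interaction s r + interaction t r"
    if "s \<in> sets (completion \<nu>)" "t \<in> sets (completion \<nu>)" "r \<in> sets (completion \<nu>)" "s \<inter> t = {}" for r s t
    using that by (rule interaction_union_left)
  have right: "interaction r (s \<union> t) = interaction r s + interaction r t"
    if "r \<in> sets (completion \<nu>)" "s \<in> sets (completion \<nu>)" "t \<in> sets (completion \<nu>)" "s \<inter> t = {}" for r s t
    using that by (rule interaction_union_right)
  have cd: "c \<union> d \<in> sets (completion \<nu>)" "b \<union> d \<in> sets (completion \<nu>)"
    using sets by auto
  have "interaction (a \<union> c) (b \<union> d) = interaction a b + interaction a d + interaction b c + interaction c d"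
    by (simp add: left right sets cd disj commute add_ac)
  then show "m_perimeter m \<nu> F = interaction a b + interaction a d + interaction b c + interaction c d"
    unfolding m_perimeter_def by (simp only: decomp(1,2)[symmetric])
  have "interaction (a \<union> b) (c \<union> d) = interaction a c + interaction a d + interaction b c + interaction b d"
    by (simp add: left right sets cd disj commute add_ac)
  then show "m_perimeter m \<nu> \<Omega> = interaction a c + interaction a d + interaction b c + interaction b d"
    unfolding m_perimeter_def by (simp only: decomp(3,4)[symmetric])
  show "m_perimeter m \<nu> a = interaction a b + interaction a c + interaction a d"
    unfolding m_perimeter_def decomp(5)
    by (simp add: right sets cd disj Int_Un_distrib add_ac)
  show "m_perimeter m \<nu> b = interaction a b + interaction b c + interaction b d"
    unfolding m_perimeter_def decomp(6)
    by (simp add: right sets cd disj Int_Un_distrib commute add_ac)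
  have "interaction c (a \<union> b) = interaction a c + interaction b c"
    by (simp add: right sets disj commute add_ac)
  then show "interaction c \<Omega> = interaction a c + interaction b c"
    by (simp only: decomp(3)[symmetric])
qed

text \<open>
  The two halves of \<open>\<bar>\<integral>\<^sub>F w d\<nu>\<bar> \<le> P(F)\<close>. The first follows from calibrability tested on
  \<open>\<Omega> \<inter> F\<close>. The second follows from \<open>\<Omega> - F\<close>: by the definition of the ratio, a lower bound for the
  perimeter of \<open>\<Omega> - F\<close> by its measure is an upper bound for \<open>P(\<Omega>) - P(\<Omega> - F)\<close> by the measure of
  \<open>\<Omega> \<inter> F\<close>.
\<close>

lemma calibrable_set_bounds:
  assumes cal: "m_calibrable m \<nu> \<Omega>" and F: "F \<in> sets (completion \<nu>)"
  shows "ratio * emeasure (completion \<nu>) (\<Omega> \<inter> F) \<le> m_perimeter m \<nu> F + interaction (F - \<Omega>) \<Omega>"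
    and "interaction (F - \<Omega>) \<Omega> \<le> m_perimeter m \<nu> F + ratio * emeasure (completion \<nu>) (\<Omega> \<inter> F)"
proof -
  define a b c d where "a = \<Omega> \<inter> F" and "b = \<Omega> - F" and "c = F - \<Omega>" and "d = - (\<Omega> \<union> F)"
  note pieces = perimeter_four_pieces[OF F, folded a_def b_def c_def d_def]
  have ab: "a \<in> sets (completion \<nu>)" "b \<in> sets (completion \<nu>)" "a \<subseteq> \<Omega>" "b \<subseteq> \<Omega>"
    unfolding a_def b_def using F \<Omega> by auto
  have cal_a: "ratio * emeasure (completion \<nu>) a \<le> m_perimeter m \<nu> a"
    and cal_b: "ratio * emeasure (completion \<nu>) b \<le> m_perimeter m \<nu> b"
    using cal ab unfolding calibrable_iff by auto
  (* In both chains the term added on the right is the excess of one side of the claim over the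
     other, read off from the four-piece formulas. *)
  note cal_a
  also have "m_perimeter m \<nu> a \<le> m_perimeter m \<nu> a + (interaction c d + interaction b c + interaction b c)"
    by simp
  also have "\<dots> = m_perimeter m \<nu> F + interaction c \<Omega>"
    unfolding pieces by (simp add: add_ac)
  finally show "ratio * emeasure (completion \<nu>) (\<Omega> \<inter> F) \<le> m_perimeter m \<nu> F + interaction (F - \<Omega>) \<Omega>"
    unfolding a_def c_def .
  have "interaction c \<Omega> + m_perimeter m \<nu> b \<le>
      interaction c \<Omega> + m_perimeter m \<nu> b + (interaction a d + interaction c d + interaction a d)"
    by simp
  also have "\<dots> = m_perimeter m \<nu> F + m_perimeter m \<nu> \<Omega>"
    unfolding pieces by (simp add: add_ac)
  also have "m_perimeter m \<nu> \<Omega> = ratio * emeasure (completion \<nu>) a + ratio * emeasure (completion \<nu>) b"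
  proof -
    have "emeasure (completion \<nu>) \<Omega> = emeasure (completion \<nu>) a + emeasure (completion \<nu>) b"
      using ab by (subst plus_emeasure) (auto simp: a_def b_def Int_Diff_Un)
    then show ?thesis
      unfolding ratio_times_measure[symmetric] by (simp add: distrib_left)
  qed
  also have "m_perimeter m \<nu> F + (ratio * emeasure (completion \<nu>) a + ratio * emeasure (completion \<nu>) b)
      \<le> m_perimeter m \<nu> F + ratio * emeasure (completion \<nu>) a + m_perimeter m \<nu> b"
    using cal_b by (simp add: add_mono add.assoc)
  finally have "m_perimeter m \<nu> b + interaction c \<Omega> \<le>
      m_perimeter m \<nu> b + (m_perimeter m \<nu> F + ratio * emeasure (completion \<nu>) a)"
    by (simp add: add_ac)
  (* The perimeter of b can be cancelled because it is finite. *)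
  moreover have "m_perimeter m \<nu> b \<noteq> \<infinity>"
    using perimeter_le_measure[OF ab(2)] measure_subset_finite[OF ab(4)] by auto
  ultimately show "interaction (F - \<Omega>) \<Omega> \<le> m_perimeter m \<nu> F + ratio * emeasure (completion \<nu>) (\<Omega> \<inter> F)"
    unfolding a_def c_def by (simp add: ennreal_add_left_cancel_le)
qed

section \<open>Subgradients at the characteristic function\<close>

text \<open>
  The subgradient is \<open>w = inner_weight - outer_weight\<close>; the two parts are nonnegative and have
  disjoint supports.
\<close>

abbreviation inner_weight :: "'a \<Rightarrow> real" where
  "inner_weight x \<equiv> enn2real ratio * indicator \<Omega> x"

abbreviation outer_weight :: "'a \<Rightarrow> real" where
  "outer_weight x \<equiv> measure (completion (m x)) \<Omega> * indicator (- \<Omega>) x"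

lemma ratio_finite: "ratio < \<top>"
  using ratio_le_1 by (rule le_less_trans) simp

lemma ennreal_inner_weight: "ennreal (inner_weight x) = ratio * indicator \<Omega> x"
  using ratio_finite by (simp add: indicator_def)

lemma ennreal_outer_weight:
  "ennreal (outer_weight x) = emeasure (completion (m x)) \<Omega> * indicator (- \<Omega>) x"
proof -
  have "emeasure (completion (m x)) \<Omega> \<noteq> \<top>"
    using emeasure_completion_kernel_le_1[of x \<Omega>] by (metis ennreal_one_neq_top top.extremum_unique)
  then show ?thesis
    by (simp add: indicator_def emeasure_eq_ennreal_measure)
qed

lemma outer_weight_le_1: "outer_weight x \<le> 1"
  using emeasure_completion_kernel_le_1[of x \<Omega>]
  by (auto simp: indicator_def measure_def enn2real_leI)

lemma inner_weight_L2: "inner_weight \<in> L2_functions \<nu>"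
proof -
  have "integrable (completion \<nu>) (\<lambda>x. (enn2real ratio)\<^sup>2 * indicator \<Omega> x)"
    using \<Omega> \<Omega>_fin by simp
  moreover have "(inner_weight x)\<^sup>2 = (enn2real ratio)\<^sup>2 * indicator \<Omega> x" for x
    by (simp add: indicator_def)
  ultimately show ?thesis
    unfolding L2_functions_def using \<Omega> by auto
qed

text \<open>
  Integrated over the complement of \<open>\<Omega>\<close>, the function \<open>m\<^sub>x(\<Omega>)\<close> gives the perimeter of \<open>\<Omega>\<close>, so it is
  integrable; being at most \<open>1\<close>, it dominates its square.
\<close>

lemma outer_weight_L2: "outer_weight \<in> L2_functions \<nu>"
proof -
  note [measurable] = \<Omega> compl_completion[OF \<Omega>] emeasure_completion_kernel_measurable[OF \<Omega>]
  have meas [measurable]: "outer_weight \<in> borel_measurable (completion \<nu>)"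
    unfolding measure_def by measurable
  have "(\<integral>\<^sup>+x. ennreal (outer_weight x) \<partial>completion \<nu>) = interaction (- \<Omega>) \<Omega>"
    unfolding ennreal_outer_weight m_interaction_def ..
  also have "\<dots> = m_perimeter m \<nu> \<Omega>"
    unfolding m_perimeter_def by (rule interaction_commute) measurable
  also have "\<dots> < \<infinity>"
    using perimeter_le_measure[OF \<Omega>] \<Omega>_fin by (rule le_less_trans)
  finally have int: "integrable (completion \<nu>) outer_weight"
    by (intro integrableI_nonneg) auto
  have "integrable (completion \<nu>) (\<lambda>x. (outer_weight x)\<^sup>2)"
  proof (rule Bochner_Integration.integrable_bound[OF int])
    show "AE x in completion \<nu>. norm ((outer_weight x)\<^sup>2) \<le> norm (outer_weight x)"
      using outer_weight_le_1
      by (auto simp: power2_eq_square intro!: mult_left_le)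
  qed measurable
  with meas show ?thesis
    unfolding L2_functions_def by simp
qed

lemma calibrable_function_bounds:
  fixes f :: "'a \<Rightarrow> real"
  assumes cal: "m_calibrable m \<nu> \<Omega>"
    and f [measurable]: "f \<in> borel_measurable borel" and nonneg: "\<And>x. 0 \<le> f x"
  shows "(\<integral>\<^sup>+x. ennreal (inner_weight x) * ennreal (f x) \<partial>\<nu>) \<le>
      total_variation f + (\<integral>\<^sup>+x. ennreal (outer_weight x) * ennreal (f x) \<partial>\<nu>)"
    and "(\<integral>\<^sup>+x. ennreal (outer_weight x) * ennreal (f x) \<partial>\<nu>) \<le>
      total_variation f + (\<integral>\<^sup>+x. ennreal (inner_weight x) * ennreal (f x) \<partial>\<nu>)"
proof -
  have meas: "(\<lambda>x. ennreal (inner_weight x)) \<in> borel_measurable (completion \<nu>)"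
      "(\<lambda>x. ennreal (outer_weight x)) \<in> borel_measurable (completion \<nu>)"
    using inner_weight_L2 outer_weight_L2 unfolding L2_functions_def by auto
  have inner: "(\<integral>\<^sup>+x\<in>F. ennreal (inner_weight x) \<partial>\<nu>) = ratio * emeasure (completion \<nu>) (\<Omega> \<inter> F)"
    and outer: "(\<integral>\<^sup>+x\<in>F. ennreal (outer_weight x) \<partial>\<nu>) = interaction (F - \<Omega>) \<Omega>"
    if F: "F \<in> sets borel" for F
  proof -
    have "\<Omega> \<inter> F \<in> sets (completion \<nu>)"
      using F \<Omega> by auto
    then have "(\<integral>\<^sup>+x. ratio * indicator (\<Omega> \<inter> F) x \<partial>completion \<nu>) = ratio * emeasure (completion \<nu>) (\<Omega> \<inter> F)"
      by (rule nn_integral_cmult_indicator)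
    moreover have "(\<integral>\<^sup>+x\<in>F. ennreal (inner_weight x) \<partial>\<nu>) =
        (\<integral>\<^sup>+x. ratio * indicator (\<Omega> \<inter> F) x \<partial>completion \<nu>)"
      unfolding ennreal_inner_weight nn_integral_completion
      by (intro nn_integral_cong) (simp add: indicator_def)
    ultimately show "(\<integral>\<^sup>+x\<in>F. ennreal (inner_weight x) \<partial>\<nu>) = ratio * emeasure (completion \<nu>) (\<Omega> \<inter> F)"
      by simp
    show "(\<integral>\<^sup>+x\<in>F. ennreal (outer_weight x) \<partial>\<nu>) = interaction (F - \<Omega>) \<Omega>"
      unfolding ennreal_outer_weight m_interaction_def nn_integral_completion
      by (intro nn_integral_cong) (auto simp: indicator_def)
  qed
  have "F \<in> sets (completion \<nu>)" if "F \<in> sets borel" for F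
    using that by simp
  note bounds = calibrable_set_bounds[OF cal this]
  show "(\<integral>\<^sup>+x. ennreal (inner_weight x) * ennreal (f x) \<partial>\<nu>) \<le>
      total_variation f + (\<integral>\<^sup>+x. ennreal (outer_weight x) * ennreal (f x) \<partial>\<nu>)"
    using meas f nonneg
    by (rule total_variation_bound_of_perimeter_bound) (simp only: inner outer bounds)
  show "(\<integral>\<^sup>+x. ennreal (outer_weight x) * ennreal (f x) \<partial>\<nu>) \<le>
      total_variation f + (\<integral>\<^sup>+x. ennreal (inner_weight x) * ennreal (f x) \<partial>\<nu>)"
    using meas(2,1) f nonneg
    by (rule total_variation_bound_of_perimeter_bound) (simp only: inner outer bounds)
qed

lemma indicator_L2:
  assumes "E \<in> sets (completion \<nu>)" "E \<subseteq> \<Omega>"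
  shows "indicator E \<in> L2_functions \<nu>"
proof -
  have "integrable (completion \<nu>) (indicator E :: 'a \<Rightarrow> real)"
    using assms measure_subset_finite by simp
  moreover have "(indicator E x :: real)\<^sup>2 = indicator E x" for x
    by (simp add: indicator_def)
  ultimately show ?thesis
    unfolding L2_functions_def using assms by auto
qed

lemma total_variation_indicator_ratio:
  "total_variation (indicator \<Omega>) = ennreal (enn2real ratio * measure (completion \<nu>) \<Omega>)"
  unfolding total_variation_indicator[OF \<Omega>] ratio_times_measure[symmetric]
  using ratio_finite \<Omega>_fin by (simp add: ennreal_mult emeasure_eq_ennreal_measure)

text \<open>
  With \<open>a = z\<^sup>+\<close> and \<open>b = z\<^sup>-\<close> the bounds \<open>\<integral> w a d\<nu> \<le> TV(a)\<close> and \<open>- \<integral> w b d\<nu> \<le> TV(b)\<close> add up to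
  \<open>\<integral> w z d\<nu> \<le> TV(z)\<close>. The remaining term \<open>\<integral> w \<chi>\<^sub>\<Omega> d\<nu>\<close> cancels the value of the functional at
  \<open>\<chi>\<^sub>\<Omega>\<close>.
\<close>

lemma calibrable_weight_subgradient:
  assumes cal: "m_calibrable m \<nu> \<Omega>"
  shows "(\<lambda>x. inner_weight x - outer_weight x) \<in> L2_subdifferential \<nu> total_variation (indicator \<Omega>)"
proof -
  have "enn2ereal (total_variation z) \<ge> enn2ereal (total_variation (indicator \<Omega>)) +
      ereal (\<integral>x. (inner_weight x - outer_weight x) * (z x - indicator \<Omega> x) \<partial>completion \<nu>)"
    if z: "z \<in> L2_functions \<nu>" for z
  proof -
    have "z \<in> borel_measurable (completion \<nu>)"
      using z unfolding L2_functions_def by simp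
    from completion_ex_borel_measurable_real[OF this] obtain z'
      where z'_nu: "z' \<in> borel_measurable \<nu>" and zz': "AE x in \<nu>. z x = z' x" by blast
    from z'_nu have z' [measurable]: "z' \<in> borel_measurable borel"
      by (simp cong: measurable_cong_sets)
    (* a and b are the positive and negative parts of a Borel version of z; Ga, Ha, Gb, Hb below are
       their integrals against the inner and outer weight. *)
    define a b where "a = (\<lambda>x. max 0 (z' x))" and "b = (\<lambda>x. max 0 (- z' x))"
    have a_meas: "a \<in> borel_measurable borel" and b_meas: "b \<in> borel_measurable borel"
      and a_nn: "\<And>x. 0 \<le> a x" and b_nn: "\<And>x. 0 \<le> b x"
      unfolding a_def b_def by auto
    have to_completion: "f \<in> borel_measurable (completion \<nu>)" if "f \<in> borel_measurable borel" for f :: "'a \<Rightarrow> real"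
      using that by (intro measurable_completion) (simp cong: measurable_cong_sets)
    have ab_L2: "a \<in> L2_functions \<nu>" "b \<in> L2_functions \<nu>"
      using AE_completion[OF zz']
      by (auto intro!: L2_mono[OF z] to_completion a_meas b_meas elim!: eventually_mono simp: a_def b_def)
    have int: "integrable (completion \<nu>) (\<lambda>x. inner_weight x * a x)"
        "integrable (completion \<nu>) (\<lambda>x. outer_weight x * a x)"
        "integrable (completion \<nu>) (\<lambda>x. inner_weight x * b x)"
        "integrable (completion \<nu>) (\<lambda>x. outer_weight x * b x)"
      by (rule L2_integrable_mult[OF inner_weight_L2 ab_L2(1)]
               L2_integrable_mult[OF outer_weight_L2 ab_L2(1)]
               L2_integrable_mult[OF inner_weight_L2 ab_L2(2)]
               L2_integrable_mult[OF outer_weight_L2 ab_L2(2)])+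
    define Ga Ha Gb Hb where "Ga = (\<integral>x. inner_weight x * a x \<partial>completion \<nu>)"
      and "Ha = (\<integral>x. outer_weight x * a x \<partial>completion \<nu>)"
      and "Gb = (\<integral>x. inner_weight x * b x \<partial>completion \<nu>)"
      and "Hb = (\<integral>x. outer_weight x * b x \<partial>completion \<nu>)"
    have nn: "0 \<le> Ga" "0 \<le> Ha" "0 \<le> Gb" "0 \<le> Hb"
      unfolding Ga_def Ha_def Gb_def Hb_def using a_nn b_nn by auto
    have to_nn: "(\<integral>\<^sup>+x. ennreal (v x) * ennreal (f x) \<partial>\<nu>) = ennreal (\<integral>x. v x * f x \<partial>completion \<nu>)"
      if "integrable (completion \<nu>) (\<lambda>x. v x * f x)" "\<And>x. 0 \<le> v x" "\<And>x. 0 \<le> f x" for v f :: "'a \<Rightarrow> real"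
      using nn_integral_eq_integral[OF that(1)] that(2,3)
      by (simp add: nn_integral_completion ennreal_mult)
    have bound_a: "ennreal Ga \<le> total_variation a + ennreal Ha"
      using calibrable_function_bounds(1)[OF cal a_meas a_nn] int a_nn
      by (simp add: to_nn Ga_def Ha_def)
    have bound_b: "ennreal Hb \<le> total_variation b + ennreal Gb"
      using calibrable_function_bounds(2)[OF cal b_meas b_nn] int b_nn
      by (simp add: to_nn Gb_def Hb_def)
    have int\<Omega>: "integrable (completion \<nu>) inner_weight"
      using \<Omega> \<Omega>_fin by simp
    have "(\<integral>x. (inner_weight x - outer_weight x) * (z x - indicator \<Omega> x) \<partial>completion \<nu>) =
        (\<integral>x. inner_weight x * a x - outer_weight x * a x
            - (inner_weight x * b x - outer_weight x * b x) - inner_weight x \<partial>completion \<nu>)"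
    proof (rule integral_cong_AE)
      show "AE x in completion \<nu>. (inner_weight x - outer_weight x) * (z x - indicator \<Omega> x) =
          inner_weight x * a x - outer_weight x * a x
            - (inner_weight x * b x - outer_weight x * b x) - inner_weight x"
        using AE_completion[OF zz']
        by eventually_elim (auto simp: a_def b_def indicator_def max_def algebra_simps)
      show "(\<lambda>x. (inner_weight x - outer_weight x) * (z x - indicator \<Omega> x)) \<in> borel_measurable (completion \<nu>)"
        using L2_diff[OF inner_weight_L2 outer_weight_L2] L2_diff[OF z indicator_L2[OF \<Omega> subset_refl]]
        by (intro borel_measurable_times) (auto simp: L2_functions_def)
    qed (use int int\<Omega> in \<open>auto intro!: borel_measurable_diff\<close>)
    also have "\<dots> = Ga - Ha - (Gb - Hb) - enn2real ratio * measure (completion \<nu>) \<Omega>"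
      using int int\<Omega> by (simp add: Ga_def Ha_def Gb_def Hb_def)
    finally have pairing: "(\<integral>x. (inner_weight x - outer_weight x) * (z x - indicator \<Omega> x) \<partial>completion \<nu>) =
        Ga - Ha - (Gb - Hb) - enn2real ratio * measure (completion \<nu>) \<Omega>" .
    have TV_z: "total_variation z = total_variation a + total_variation b"
      using total_variation_cong_AE[OF zz'] total_variation_pos_neg_parts[OF z']
      by (simp add: a_def b_def)
    have TV_bound: "ereal (Ga - Ha - (Gb - Hb)) \<le> enn2ereal (total_variation z)"
    proof (cases "total_variation a = \<top> \<or> total_variation b = \<top>")
      case True
      then show ?thesis
        unfolding TV_z by auto
    next
      case False
      then obtain s t where st: "total_variation a = ennreal s" "total_variation b = ennreal t" "0 \<le> s" "0 \<le> t"
        by (cases "total_variation a"; cases "total_variation b") auto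
      have "Ga \<le> s + Ha" "Hb \<le> t + Gb"
        using bound_a bound_b st nn by (simp_all flip: ennreal_plus)
      then show ?thesis
        unfolding TV_z st using st by (simp flip: ennreal_plus)
    qed
    have "enn2ereal (total_variation (indicator \<Omega>)) = ereal (enn2real ratio * measure (completion \<nu>) \<Omega>)"
      unfolding total_variation_indicator_ratio by simp
    then show ?thesis
      unfolding pairing using TV_bound
      by (simp only: plus_ereal.simps add_diff_cancel_left' add.commute[of _ "_ - _"] diff_add_cancel)
  qed
  then show ?thesis
    unfolding L2_subdifferential_def
    using L2_diff[OF inner_weight_L2 outer_weight_L2] total_variation_indicator_ratio by auto
qed

text \<open>
  The test functions \<open>\<chi>\<^sub>E\<close> with \<open>E \<subseteq> \<Omega>\<close> see the subgradient on \<open>\<Omega>\<close> only, where it is the constant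
  \<open>ratio\<close>.
\<close>

lemma calibrable_of_one_laplacian:
  assumes one: "\<And>x. x \<in> \<Omega> \<Longrightarrow> \<tau> x = 1"
    and lap: "(\<lambda>x. - enn2real ratio * \<tau> x) \<in> one_laplacian m \<nu> (indicator \<Omega>)"
  shows "m_calibrable m \<nu> \<Omega>"
  unfolding calibrable_iff
proof (intro ballI impI)
  fix E
  assume E: "E \<in> sets (completion \<nu>)" and sub: "E \<subseteq> \<Omega>"
  have fin: "emeasure (completion \<nu>) E = ennreal (measure (completion \<nu>) E)"
    using measure_subset_finite[OF sub] by (simp add: emeasure_eq_ennreal_measure)
  have ratio: "ratio = ennreal (enn2real ratio)"
    using ratio_finite by simp
  have "enn2ereal (total_variation (indicator \<Omega>)) +
      ereal (\<integral>x. enn2real ratio * \<tau> x * (indicator E x - indicator \<Omega> x) \<partial>completion \<nu>)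
      \<le> enn2ereal (total_variation (indicator E))"
    using lap indicator_L2[OF E sub] unfolding one_laplacian_def L2_subdifferential_def by auto
  moreover have "(\<integral>x. enn2real ratio * \<tau> x * (indicator E x - indicator \<Omega> x) \<partial>completion \<nu>) =
      (\<integral>x. enn2real ratio * (indicator E x - indicator \<Omega> x) \<partial>completion \<nu>)"
    using one sub by (intro Bochner_Integration.integral_cong) (auto simp: indicator_def)
  moreover have "\<dots> = enn2real ratio * (measure (completion \<nu>) E - measure (completion \<nu>) \<Omega>)"
    using E \<Omega> measure_subset_finite[OF sub] \<Omega>_fin by simp
  moreover note total_variation_indicator_ratio
  ultimately have "ereal (enn2real ratio * measure (completion \<nu>) E) \<le> enn2ereal (m_perimeter m \<nu> E)"
    by (simp add: total_variation_indicator[OF E] algebra_simps)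
  then have "ennreal (enn2real ratio * measure (completion \<nu>) E) \<le> m_perimeter m \<nu> E"
    by (simp add: less_eq_ennreal.rep_eq)
  then show "ratio * emeasure (completion \<nu>) E \<le> m_perimeter m \<nu> E"
    by (subst fin, subst ratio) (simp add: ennreal_mult)
qed

lemma ratio_pos:
  assumes "m_connected m \<nu>" "emeasure (completion \<nu>) \<Omega> < emeasure (completion \<nu>) UNIV"
  shows "0 < ratio"
proof -
  have compl: "- \<Omega> \<in> sets (completion \<nu>)"
    by (rule compl_completion[OF \<Omega>])
  have "emeasure (completion \<nu>) UNIV = emeasure (completion \<nu>) \<Omega> + emeasure (completion \<nu>) (- \<Omega>)"
    using \<Omega> compl by (subst plus_emeasure) auto
  then have "0 < emeasure (completion \<nu>) (- \<Omega>)"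
    using assms(2) by (auto simp: zero_less_iff_neq_zero)
  then have "0 < m_perimeter m \<nu> \<Omega>"
    using assms(1) \<Omega> compl \<Omega>_pos unfolding m_connected_def m_perimeter_def by auto
  then show ?thesis
    unfolding ratio_times_measure[symmetric] by (auto simp: zero_less_iff_neq_zero)
qed

end

end

theorem theorem5p7:
  fixes m :: "'a::polish_space \<Rightarrow> 'a measure"
    and \<nu> :: "'a measure"
    and \<Omega> :: "'a set"
  assumes "reversible_random_walk m \<nu>"
    and "m_connected m \<nu>"
    and "\<Omega> \<in> sets (completion \<nu>)"
    and "0 < emeasure (completion \<nu>) \<Omega>"
    and "emeasure (completion \<nu>) \<Omega> < emeasure (completion \<nu>) UNIV"
  shows "(m_calibrable m \<nu> \<Omega> \<longleftrightarrow>
           (\<exists>\<tau> \<in> borel_measurable (completion \<nu>). (\<forall>x\<in>\<Omega>. \<tau> x = 1) \<and>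
              (\<lambda>x. - enn2real (perimeter_ratio m \<nu> \<Omega>) * \<tau> x) \<in> one_laplacian m \<nu> (indicator \<Omega>)))
       \<and> (m_calibrable m \<nu> \<Omega> \<longleftrightarrow>
           (\<lambda>x. - enn2real (perimeter_ratio m \<nu> \<Omega>) *
              (if x \<in> \<Omega> then 1
               else - (1 / enn2real (perimeter_ratio m \<nu> \<Omega>)) * measure (completion (m x)) \<Omega>))
              \<in> one_laplacian m \<nu> (indicator \<Omega>))"
proof -
  interpret reversible_random_walk m \<nu>
    by fact
  have fin: "emeasure (completion \<nu>) \<Omega> < \<infinity>"
    using assms(5) by (auto intro: less_le_trans)
  note \<Omega> = assms(3,4) fin
  let ?r = "enn2real (perimeter_ratio m \<nu> \<Omega>)"
  let ?t = "\<lambda>x. if x \<in> \<Omega> then 1 else - (1 / ?r) * measure (completion (m x)) \<Omega>"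
  let ?w = "\<lambda>x. ?r * indicator \<Omega> x - measure (completion (m x)) \<Omega> * indicator (- \<Omega>) x"
  have pos: "0 < ?r"
    using ratio_pos[OF \<Omega> assms(2,5)] ratio_finite[OF \<Omega>] by (simp add: enn2real_positive_iff)
  have w_L2: "?w \<in> L2_functions \<nu>"
    by (rule L2_diff[OF inner_weight_L2[OF \<Omega>] outer_weight_L2[OF \<Omega>]])
  have t_meas: "?t \<in> borel_measurable (completion \<nu>)"
  proof -
    have "?t = (\<lambda>x. ?w x / ?r)"
      using pos by (auto simp: indicator_def)
    moreover have "(\<lambda>x. ?w x / ?r) \<in> borel_measurable (completion \<nu>)"
      using w_L2 unfolding L2_functions_def by (intro borel_measurable_divide) auto
    ultimately show ?thesis by simp
  qed
  have laplacian: "(\<lambda>x. - ?r * ?t x) \<in> one_laplacian m \<nu> (indicator \<Omega>)" if "m_calibrable m \<nu> \<Omega>"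
  proof -
    have "(\<lambda>x. - ?r * ?t x) = (\<lambda>x. - ?w x)"
      using pos by (auto simp: fun_eq_iff indicator_def)
    moreover have "(\<lambda>x. - ?w x) \<in> L2_functions \<nu>"
      using L2_diff[OF outer_weight_L2[OF \<Omega>] inner_weight_L2[OF \<Omega>]] by simp
    moreover have "(\<lambda>x. - (- ?w x)) \<in> L2_subdifferential \<nu> (m_total_variation m \<nu>) (indicator \<Omega>)"
      using calibrable_weight_subgradient[OF \<Omega> that] by simp
    ultimately show ?thesis
      using indicator_L2[OF \<Omega> assms(3) subset_refl] unfolding one_laplacian_def by simp
  qed
  have calibrable: "m_calibrable m \<nu> \<Omega>"
    if "\<forall>x\<in>\<Omega>. \<tau> x = 1" "(\<lambda>x. - ?r * \<tau> x) \<in> one_laplacian m \<nu> (indicator \<Omega>)" for \<tau>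
    using that by (intro calibrable_of_one_laplacian[OF \<Omega>, of \<tau>]) auto
  have t_1: "\<forall>x\<in>\<Omega>. ?t x = 1"
    by simp
  show ?thesis
  proof (intro conjI iffI)
    assume "m_calibrable m \<nu> \<Omega>"
    with t_meas t_1 show "\<exists>\<tau> \<in> borel_measurable (completion \<nu>). (\<forall>x\<in>\<Omega>. \<tau> x = 1) \<and>
        (\<lambda>x. - ?r * \<tau> x) \<in> one_laplacian m \<nu> (indicator \<Omega>)"
      by (intro bexI[of _ ?t] conjI laplacian)
  next
    assume "\<exists>\<tau> \<in> borel_measurable (completion \<nu>). (\<forall>x\<in>\<Omega>. \<tau> x = 1) \<and>
        (\<lambda>x. - ?r * \<tau> x) \<in> one_laplacian m \<nu> (indicator \<Omega>)"
    then show "m_calibrable m \<nu> \<Omega>"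
      by (elim bexE conjE) (rule calibrable)
  next
    assume "m_calibrable m \<nu> \<Omega>"
    then show "(\<lambda>x. - ?r * ?t x) \<in> one_laplacian m \<nu> (indicator \<Omega>)"
      by (rule laplacian)
  next
    assume "(\<lambda>x. - ?r * ?t x) \<in> one_laplacian m \<nu> (indicator \<Omega>)"
    with t_1 show "m_calibrable m \<nu> \<Omega>"
      by (rule calibrable)
  qed
qed

end
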